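(* Let $X$ be a real Hilbert space, let $\Omega\subset X$ be non-empty, and let $(F_n)_{n\ge 1}$ be a sequence of point-to-set maps $F_n:X\rightrightarrows X$ which satisfies properties P1 and P2 with respect to $\Omega$. Let $(x_n)_{n\ge 0}$ and $(r_n)_{n\ge 1}$ be sequences in $X$ such that $$x_n\in F_n(x_{n-1})+r_n,\quad n=1,2,\dots,\qquad \sum_{n=1}^\infty\|r_n\|<\infty .$$ Then $(x_n)$ is Quasi-Fejér convergent to $\Omega$, it converges weakly to some $\bar x\in\Omega$, and for any $x^*\in\Omega$ the limit $\lim_{n\to\infty}\|x^*-x_n\|$ exists. Moreover, if $r_n=0$ for all $n$, then $(x_n)$ is Fejér convergent to $\Omega$.
   Context: A point-to-set map $F:X\rightrightarrows X$ is a function from $X$ to the power set of $X$ (values may be empty); $F(x)+r=\{y+r : y\in F(x)\}$. Properties of a sequence $(F_n:X\rightrightarrows X)_{n\in\mathbb N}$ with respect to $\Omega\subset X$: P1: if $\hat x\in F_n(x)$ (for some $n$ and $x\in X$) and $x^*\in\Omega$, then $\|x^*-\hat x\|\le\|x^*-x\|$. P2: if $(z_k)_{k\in\mathbb N}$ converges weakly to $\bar z$, $\hat z_k\in F_{n_k}(z_k)$ for all $k$ with $n_1<n_2<\cdots$, and for some $x^*\in\Omega$ one has $\lim_{k\to\infty}\left(\|x^*-z_k\|-\|x^*-\hat z_k\|\right)=0$, then $\bar z\in\Omega$. A sequence $(x_n)$ is Quasi-Fejér convergent to $\Omega$ if for each $x^*\in\Omega$ there is a non-negative summable sequence $(\rho_n)$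 such that $\|x^*-x_n\|\le\|x^*-x_{n-1}\|+\rho_n$ for $n=1,2,\dots$. It is Fejér convergent to $\Omega$ if $\|x^*-x_n\|\le\|x^*-x_{n-1}\|$ for all $x^*\in\Omega$ and $n=1,2,\dots$. *)

theory Defs
  imports "HOL-Analysis.Analysis"
begin

definition weakly_converges :: "(nat \<Rightarrow> 'a::real_normed_vector) \<Rightarrow> 'a \<Rightarrow> bool" where
  "weakly_converges x l \<longleftrightarrow>
     (\<forall>f :: 'a \<Rightarrow> real. bounded_linear f \<longrightarrow> (\<lambda>n. f (x n)) \<longlonglongrightarrow> f l)"

(* The maps F n, the perturbations r n and the error bounds \<rho> n are indexed by n \<ge> 1;
   their values at 0 are irrelevant.  Series over n \<ge> 1 are written with Suc n. *)

definition P1 :: "(nat \<Rightarrow> 'a \<Rightarrow> 'a set) \<Rightarrow> 'a::real_normed_vector set \<Rightarrow> bool" where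
  "P1 F \<Omega> \<longleftrightarrow>
     (\<forall>n\<ge>1. \<forall>x. \<forall>x'\<in>F n x. \<forall>s\<in>\<Omega>. norm (s - x') \<le> norm (s - x))"

(* The index k of z, z' and m starts at 0 instead of 1; m k is the index n_k. *)

definition P2 :: "(nat \<Rightarrow> 'a \<Rightarrow> 'a set) \<Rightarrow> 'a::real_normed_vector set \<Rightarrow> bool" where
  "P2 F \<Omega> \<longleftrightarrow>
     (\<forall>(z :: nat \<Rightarrow> 'a) z' zbar (m :: nat \<Rightarrow> nat).
        weakly_converges z zbar \<longrightarrow>
        strict_mono m \<longrightarrow> (\<forall>k. m k \<ge> 1) \<longrightarrow>
        (\<forall>k. z' k \<in> F (m k) (z k)) \<longrightarrow>
        (\<exists>s\<in>\<Omega>. (\<lambda>k. norm (s - z k) - norm (s - z' k)) \<longlonglongrightarrow> 0) \<longrightarrow>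
        zbar \<in> \<Omega>)"

definition quasi_fejer :: "(nat \<Rightarrow> 'a) \<Rightarrow> 'a::real_normed_vector set \<Rightarrow> bool" where
  "quasi_fejer x \<Omega> \<longleftrightarrow>
     (\<forall>s\<in>\<Omega>. \<exists>\<rho> :: nat \<Rightarrow> real.
        (\<forall>n\<ge>1. 0 \<le> \<rho> n) \<and> summable (\<lambda>n. \<rho> (Suc n)) \<and>
        (\<forall>n\<ge>1. norm (s - x n) \<le> norm (s - x (n - 1)) + \<rho> n))"

definition fejer :: "(nat \<Rightarrow> 'a) \<Rightarrow> 'a::real_normed_vector set \<Rightarrow> bool" where
  "fejer x \<Omega> \<longleftrightarrow>
     (\<forall>s\<in>\<Omega>. \<forall>n\<ge>1. norm (s - x n) \<le> norm (s - x (n - 1)))"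

end

theory Submission
  imports Defs "HOL-Library.Diagonal_Subsequence"
begin

text \<open>By P1 each distance to a point of \<open>\<Omega>\<close> increases in step \<open>n\<close> by at most
  \<open>\<parallel>r n\<parallel>\<close>, so it converges. Hence \<open>x n\<close> and \<open>x (n + 1) - r (n + 1)\<close> have asymptotically equal
  distances to it, and P2 puts every weak cluster point of \<open>x\<close> into \<open>\<Omega>\<close>. Cluster points
  exist by weak sequential compactness, and Opial's argument shows that there is only one.\<close>

section \<open>Riesz representation on closed subspaces\<close>

text \<open>Near t = 0 the linear term dominates and changes sign with t. This serves as the
  first-order optimality condition at a minimizer.\<close>

lemma quadratic_nonneg_imp_zero:
  fixes a b :: real
  assumes "\<And>t. 0 \<le> t\<^sup>2 * a + 2 * t * b"
  shows "b = 0"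
proof (rule ccontr)
  assume "b \<noteq> 0"
  \<comment> \<open>At t = -b/c the quadratic equals (b^2/c) * (a/c - 2); this choice of
    \<open>c\<close> makes it negative whatever the sign of \<open>a\<close>.\<close>
  define c where "c = \<bar>a\<bar> + 1"
  have c: "c > 0" "a < c" unfolding c_def by auto
  have "0 \<le> (b/c)\<^sup>2 * a - 2 * (b/c) * b"
    using assms[of "- (b/c)"] by simp
  also have "(b/c)\<^sup>2 * a - 2 * (b/c) * b = (b\<^sup>2 / c) * (a / c - 2)"
    using c by (simp add: field_simps power2_eq_square)
  also have "\<dots> < 0"
    using c \<open>b \<noteq> 0\<close> by (intro mult_pos_neg) (auto simp: field_simps)
  finally show False by simp
qed

text \<open>The representing vector is the minimizer of \<open>v \<bullet> v - 2 * f v\<close> on \<open>S\<close>; minimizing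
  sequences are Cauchy by the parallelogram law.\<close>

lemma riesz_representation_on_subspace:
  fixes S :: "'a::{real_inner, complete_space} set" and f :: "'a \<Rightarrow> real"
  assumes S: "subspace S" "closed S"
    and add: "\<And>v w. v \<in> S \<Longrightarrow> w \<in> S \<Longrightarrow> f (v + w) = f v + f w"
    and scale: "\<And>c v. v \<in> S \<Longrightarrow> f (c *\<^sub>R v) = c * f v"
    and bound: "\<And>v. v \<in> S \<Longrightarrow> \<bar>f v\<bar> \<le> K * norm v"
  shows "\<exists>u\<in>S. \<forall>y\<in>S. f y = u \<bullet> y"
proof -
  define J where "J = (\<lambda>v. v \<bullet> v - 2 * f v)"
  have J_lower: "J v \<ge> - K\<^sup>2" if "v \<in> S" for v
  proof -
    have "J v \<ge> (norm v)\<^sup>2 - 2 * (K * norm v)"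
      using bound[OF that] by (simp add: J_def power2_norm_eq_inner)
    moreover have "(norm v - K)\<^sup>2 \<ge> 0" by simp
    ultimately show ?thesis by (simp add: power2_diff algebra_simps)
  qed
  define m where "m = Inf (J ` S)"
  have zero: "0 \<in> S" using S(1) by (rule subspace_0)
  have bdd: "bdd_below (J ` S)" using J_lower by (auto intro!: bdd_belowI)
  have m_le: "m \<le> J v" if "v \<in> S" for v
    unfolding m_def using bdd that by (simp add: cINF_lower)
  have "\<exists>v\<in>S. J v < m + 1 / real (Suc n)" for n
    using cInf_lessD[of "J ` S" "m + 1 / real (Suc n)"] zero unfolding m_def by fastforce
  then obtain v where v: "\<And>n. v n \<in> S" "\<And>n. J (v n) < m + 1 / real (Suc n)" by metis
  \<comment> \<open>The midpoint of \<open>a\<close> and \<open>b\<close> lies in \<open>S\<close>,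
    so \<open>J\<close> is at least \<open>m\<close> there. In \<open>J a + J b\<close> minus twice
    that value the \<open>f\<close> terms cancel, which leaves half the squared distance.\<close>
  have parallelogram: "(norm (a - b))\<^sup>2 / 2 \<le> (J a - m) + (J b - m)" if "a \<in> S" "b \<in> S" for a b
  proof -
    have "(1/2) *\<^sub>R (a + b) \<in> S"
      using that S(1) by (intro subspace_scale subspace_add)
    then have "m \<le> J ((1/2) *\<^sub>R (a + b))" by (rule m_le)
    moreover have "f ((1/2) *\<^sub>R (a + b)) = (f a + f b) / 2"
      using that S(1) by (simp add: scale add subspace_add)
    ultimately show ?thesis
      unfolding J_def power2_norm_eq_inner
      by (simp add: inner_simps inner_commute field_simps)
  qed
  have "Cauchy v"
  proof (rule CauchyI)
    fix e :: real assume "e > 0"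
    \<comment> \<open>Two gaps below e^2/4 add up to less than e^2/2, matching the factor 1/2 in
      \<open>parallelogram\<close>.\<close>
    then obtain N where N: "1 / real (Suc N) < e\<^sup>2 / 4"
      using reals_Archimedean[of "e\<^sup>2 / 4"] by (auto simp: inverse_eq_divide)
    have small: "J (v n) - m < e\<^sup>2 / 4" if "n \<ge> N" for n
    proof -
      have "1 / real (Suc n) \<le> 1 / real (Suc N)" using that by (intro divide_left_mono) auto
      then show ?thesis using v(2)[of n] N by linarith
    qed
    have "norm (v p - v q) < e" if "p \<ge> N" "q \<ge> N" for p q
    proof -
      have "(norm (v p - v q))\<^sup>2 < e\<^sup>2"
        using parallelogram[OF v(1)[of p] v(1)[of q]] small[OF that(1)] small[OF that(2)] by linarith
      then show ?thesis using \<open>e > 0\<close> by (meson less_imp_le power2_less_imp_less)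
    qed
    then show "\<exists>M. \<forall>p\<ge>M. \<forall>q\<ge>M. norm (v p - v q) < e" by blast
  qed
  then obtain u where u: "v \<longlonglongrightarrow> u" using Cauchy_convergent convergent_def by blast
  have uS: "u \<in> S" using closed_sequentially[OF S(2)] v(1) u by blast
  have f_lim: "(\<lambda>n. f (v n)) \<longlonglongrightarrow> f u"
  proof -
    have "(\<lambda>n. f (v n) - f u) \<longlonglongrightarrow> 0"
    proof (rule Lim_null_comparison)
      have "f (v n) - f u = f (v n - u)" for n
        using add[OF v(1)[of n], of "- u"] scale[of u "- 1"] uS S(1) subspace_neg[OF S(1) uS]
        by simp
      then show "\<forall>\<^sub>F n in sequentially. norm (f (v n) - f u) \<le> K * norm (v n - u)"
        using bound v(1) uS S(1) by (auto intro!: always_eventually simp: subspace_diff)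
      show "(\<lambda>n. K * norm (v n - u)) \<longlonglongrightarrow> 0"
        using u by (intro tendsto_mult_right_zero tendsto_norm_zero LIM_zero)
    qed
    then show ?thesis by (rule LIM_zero_cancel)
  qed
  have "J u \<le> m"
  proof (rule LIMSEQ_le)
    show "(\<lambda>n. J (v n)) \<longlonglongrightarrow> J u"
      unfolding J_def by (intro tendsto_intros u f_lim)
    show "(\<lambda>n. m + 1 / real (Suc n)) \<longlonglongrightarrow> m"
      using tendsto_add[OF tendsto_const[of m] LIMSEQ_Suc[OF lim_1_over_n]] by simp
    show "\<exists>N. \<forall>n\<ge>N. J (v n) \<le> m + 1 / real (Suc n)" using v(2) less_imp_le by blast
  qed
  \<comment> \<open>Perturbing the minimizer along \<open>y\<close> changes \<open>J\<close> by a
    quadratic in \<open>t\<close> whose linear coefficient is 2 *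
    (\<open>u \<bullet> y - f y\<close>); minimality makes it vanish.\<close>
  have "f y = u \<bullet> y" if "y \<in> S" for y
  proof -
    have "0 \<le> t\<^sup>2 * (y \<bullet> y) + 2 * t * (u \<bullet> y - f y)" for t
    proof -
      have "t *\<^sub>R y \<in> S" using that S(1) by (rule subspace_scale[rotated])
      then have "u + t *\<^sub>R y \<in> S" "f (u + t *\<^sub>R y) = f u + t * f y"
        using uS S(1) that by (simp_all add: subspace_add add scale)
      then have "J u \<le> J (u + t *\<^sub>R y)" "f (u + t *\<^sub>R y) = f u + t * f y"
        using \<open>J u \<le> m\<close> m_le[of "u + t *\<^sub>R y"] by auto
      then show ?thesis
        unfolding J_def by (simp add: inner_simps inner_commute algebra_simps power2_eq_square)
    qed
    then show ?thesis using quadratic_nonneg_imp_zero[of "y \<bullet> y" "u \<bullet> y - f y"] by simp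
  qed
  then show ?thesis using uS by blast
qed

section \<open>Weak sequential compactness of bounded sequences\<close>

lemma weakly_converges_inner:
  fixes x :: "nat \<Rightarrow> 'a::real_inner"
  assumes "weakly_converges x l"
  shows "(\<lambda>n. y \<bullet> x n) \<longlonglongrightarrow> y \<bullet> l"
  using assms bounded_linear_inner_right[of y] unfolding weakly_converges_def by blast

text \<open>Each real sequence of inner products is bounded by Cauchy-Schwarz, so
  Bolzano-Weierstrass applies for every \<open>k\<close>; a diagonal choice treats all
  \<open>k\<close> at once.\<close>

lemma diagonal_inner_convergent:
  fixes x y :: "nat \<Rightarrow> 'a::real_inner"
  assumes "\<And>n. norm (x n) \<le> B"
  shows "\<exists>s :: nat \<Rightarrow> nat. strict_mono s \<and> (\<forall>k. convergent (\<lambda>j. y k \<bullet> x (s j)))"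
proof -
  interpret subseqs "\<lambda>k s. convergent (\<lambda>j. y k \<bullet> x (s j))"
  proof
    fix k :: nat and s :: "nat \<Rightarrow> nat"
    have "\<bar>y k \<bullet> x (s j)\<bar> \<le> norm (y k) * B" for j
      by (rule order_trans[OF Cauchy_Schwarz_ineq2 mult_left_mono[OF assms]]) simp
    then have "bounded (range (\<lambda>j. y k \<bullet> x (s j)))"
      by (auto simp: bounded_iff)
    then show "\<exists>r'. strict_mono r' \<and> convergent (\<lambda>j. y k \<bullet> x ((s \<circ> r') j))"
      using bounded_imp_convergent_subsequence[of "\<lambda>j. y k \<bullet> x (s j)"]
      by (auto simp: o_def convergent_def)
  qed
  have "convergent (\<lambda>j. y k \<bullet> x (diagseq j))" for k
  proof -
    \<comment> \<open>Only from index \<open>Suc k\<close> on is the diagonal sequence known to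
      refine the subsequence chosen for \<open>k\<close>; the initial segment does not affect
      convergence.\<close>
    have "convergent (\<lambda>j. y k \<bullet> x ((diagseq \<circ> (+) (Suc k)) j))"
    proof (rule diagseq_holds)
      fix s t :: "nat \<Rightarrow> nat" and n
      assume "strict_mono s" "convergent (\<lambda>j. y n \<bullet> x (t j))"
      then show "convergent (\<lambda>j. y n \<bullet> x ((t \<circ> s) j))"
        using convergent_subseq_convergent[of "\<lambda>j. y n \<bullet> x (t j)" s] by (simp add: o_def)
    qed
    then have "convergent (\<lambda>j. y k \<bullet> x (diagseq (j + Suc k)))"
      by (simp add: o_def add.commute)
    then show ?thesis
      using convergent_ignore_initial_segment[of "\<lambda>j. y k \<bullet> x (diagseq j)" "Suc k"] by simp
  qed
  then show ?thesis using subseq_diagseq by blast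
qed

text \<open>The vectors \<open>y\<close> for which \<open>y \<bullet> x (s j)\<close> converges form a closed subspace containing
  all \<open>x k\<close>. Representing functionals on this subspace only makes an orthogonal projection
  onto it unnecessary.\<close>

lemma bounded_imp_weakly_convergent_subsequence:
  fixes x :: "nat \<Rightarrow> 'a::{real_inner, complete_space}"
  assumes B: "\<And>n. norm (x n) \<le> B"
  obtains s :: "nat \<Rightarrow> nat" and l where "strict_mono s" "weakly_converges (x \<circ> s) l"
proof -
  obtain s :: "nat \<Rightarrow> nat" where s: "strict_mono s" "\<forall>k. convergent (\<lambda>j. x k \<bullet> x (s j))"
    using diagonal_inner_convergent[where x = x and y = x, OF B] by auto
  define Y where "Y = {y. convergent (\<lambda>j. y \<bullet> x (s j))}"
  have xY: "x k \<in> Y" for k using s(2) by (simp add: Y_def)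
  have subY: "subspace Y"
    unfolding subspace_def Y_def
    by (auto simp: inner_simps convergent_const intro: convergent_add convergent_mult)
  have B0: "B \<ge> 0" using B[of 0] norm_ge_zero order_trans by blast
  have inner_bound: "\<bar>y \<bullet> x n\<bar> \<le> B * norm y" for y n
    using order_trans[OF Cauchy_Schwarz_ineq2[of y "x n"] mult_left_mono[OF B norm_ge_zero]]
    by (simp add: mult.commute)
  have closedY: "closed Y"
  proof (rule closed_sequential_limits[THEN iffD2], intro allI impI, elim conjE)
    fix w y assume w: "\<forall>n. w n \<in> Y" "w \<longlonglongrightarrow> y"
    have "Cauchy (\<lambda>j. y \<bullet> x (s j))"
    proof (rule CauchyI)
      fix e :: real assume "e > 0"
      \<comment> \<open>An e/3 argument: \<open>w N\<close> replaces \<open>y\<close> with an error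
        uniform in \<open>n\<close>. Dividing by \<open>B + 1\<close> also covers
        \<open>B = 0\<close>.\<close>
      define d where "d = e / 3 / (B + 1)"
      have "d > 0" using \<open>e > 0\<close> B0 by (simp add: d_def)
      then obtain N where N: "norm (w N - y) < d" using w(2) LIMSEQ_D by blast
      have close: "\<bar>(y - w N) \<bullet> x n\<bar> < e / 3" for n
      proof -
        have "\<bar>(y - w N) \<bullet> x n\<bar> \<le> B * d"
          using inner_bound[of "y - w N" n] mult_left_mono[OF less_imp_le[OF N] B0]
          by (simp add: norm_minus_commute)
        also have "\<dots> < (B + 1) * d" using \<open>d > 0\<close> by simp
        also have "\<dots> = e / 3" using B0 unfolding d_def
          by (metis add_nonneg_pos less_irrefl nonzero_mult_div_cancel_left times_divide_eq_right zero_less_one)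
        finally show ?thesis .
      qed
      have "Cauchy (\<lambda>j. w N \<bullet> x (s j))"
        using w(1) unfolding Y_def by (blast intro: convergent_Cauchy)
      then obtain M where M: "\<And>p q. p \<ge> M \<Longrightarrow> q \<ge> M \<Longrightarrow> \<bar>w N \<bullet> x (s p) - w N \<bullet> x (s q)\<bar> < e / 3"
        using CauchyD[of "\<lambda>j. w N \<bullet> x (s j)" "e / 3"] \<open>e > 0\<close> unfolding real_norm_def
        by (metis divide_pos_pos zero_less_numeral)
      have "norm (y \<bullet> x (s p) - y \<bullet> x (s q)) < e" if "p \<ge> M" "q \<ge> M" for p q
        using M[OF that] close[of "s p"] close[of "s q"]
        unfolding inner_diff_left real_norm_def by linarith
      then show "\<exists>M. \<forall>p\<ge>M. \<forall>q\<ge>M. norm (y \<bullet> x (s p) - y \<bullet> x (s q)) < e" by blast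
    qed
    then show "y \<in> Y" by (simp add: Y_def Cauchy_convergent_iff)
  qed
  define g where "g = (\<lambda>y. lim (\<lambda>j. y \<bullet> x (s j)))"
  have g: "(\<lambda>j. y \<bullet> x (s j)) \<longlonglongrightarrow> g y" if "y \<in> Y" for y
    using that by (simp add: Y_def g_def convergent_LIMSEQ_iff)
  \<comment> \<open>The limit functional \<open>g\<close> is linear and bounded on \<open>Y\<close>;
    its representing vector is the weak limit.\<close>
  have "\<exists>l\<in>Y. \<forall>y\<in>Y. g y = l \<bullet> y"
  proof (rule riesz_representation_on_subspace[OF subY closedY])
    show "g (v + w) = g v + g w" if "v \<in> Y" "w \<in> Y" for v w
      using LIMSEQ_unique[OF g[OF subspace_add[OF subY that]]] tendsto_add[OF g[OF that(1)] g[OF that(2)]]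
      by (simp add: inner_add_left)
    show "g (c *\<^sub>R v) = c * g v" if "v \<in> Y" for c v
      using LIMSEQ_unique[OF g[OF subspace_scale[OF subY that]]] tendsto_mult_left[OF g[OF that]]
      by simp
    show "\<bar>g v\<bar> \<le> B * norm v" if "v \<in> Y" for v
      by (rule LIMSEQ_le_const2[OF tendsto_rabs[OF g[OF that]]]) (use inner_bound in auto)
  qed
  then obtain l where l: "l \<in> Y" "\<And>y. y \<in> Y \<Longrightarrow> g y = l \<bullet> y" by blast
  have "(\<lambda>j. f ((x \<circ> s) j)) \<longlonglongrightarrow> f l" if f: "bounded_linear f" for f :: "'a \<Rightarrow> real"
  proof -
    interpret bounded_linear f by (rule f)
    obtain K where K: "\<And>v. norm (f v) \<le> norm v * K" using bounded by blast
    \<comment> \<open>All \<open>x k\<close> and \<open>l\<close> lie in \<open>Y\<close>, so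
      \<open>f\<close> may be replaced by its representative \<open>u\<close> there, and
      \<open>f (x (s j))\<close> tends to \<open>g u\<close>, which is
      \<open>l \<bullet> u\<close>.\<close>
    have "\<exists>u\<in>Y. \<forall>y\<in>Y. f y = u \<bullet> y"
    proof (rule riesz_representation_on_subspace[OF subY closedY, of f K])
      show "\<bar>f v\<bar> \<le> K * norm v" for v using K[of v] by (simp add: mult.commute)
    qed (simp_all add: add scaleR)
    then obtain u where u: "u \<in> Y" "\<And>y. y \<in> Y \<Longrightarrow> f y = u \<bullet> y" by blast
    show ?thesis
      using g[OF u(1)] l(2)[OF u(1)] u(2)[OF xY] u(2)[OF l(1)] by (simp add: inner_commute)
  qed
  then have "weakly_converges (x \<circ> s) l" unfolding weakly_converges_def by blast
  then show thesis using that s(1) by blast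
qed

section \<open>Convergence of distances and uniqueness of weak cluster points\<close>

text \<open>Subtracting the partial sums of \<open>\<rho>\<close> makes \<open>a\<close>
  nonincreasing; it stays bounded below since these sums are bounded.\<close>

lemma convergent_of_summable_perturbation:
  fixes a \<rho> :: "nat \<Rightarrow> real"
  assumes "\<And>n. 0 \<le> a n" "\<And>n. a (Suc n) \<le> a n + \<rho> n" "summable \<rho>"
  shows "convergent a"
proof -
  define b where "b = (\<lambda>n. a n - (\<Sum>i<n. \<rho> i))"
  have sums: "(\<lambda>n. \<Sum>i<n. \<rho> i) \<longlonglongrightarrow> suminf \<rho>" using assms(3) by (rule summable_LIMSEQ)
  then obtain C where C: "\<And>n. (\<Sum>i<n. \<rho> i) \<le> C"
    using convergent_imp_Bseq[of "\<lambda>n. \<Sum>i<n. \<rho> i"]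
    by (auto simp: convergent_def Bseq_def abs_le_iff)
  have "decseq b" using assms(2) by (intro decseq_SucI) (simp add: b_def algebra_simps)
  moreover have "- C \<le> b n" for n using C[of n] assms(1)[of n] by (simp add: b_def)
  ultimately obtain L where "b \<longlonglongrightarrow> L" using decseq_convergent by blast
  from tendsto_add[OF this sums] show ?thesis by (auto simp: b_def convergent_def)
qed

text \<open>Opial's argument: \<open>\<parallel>s - x n\<parallel>\<^sup>2 - \<parallel>t - x n\<parallel>\<^sup>2\<close> is affine in \<open>x n\<close>, so its
  convergence forces \<open>(s - t) \<bullet> x n\<close> to converge and two weak cluster points to coincide.\<close>

lemma opial:
  fixes x :: "nat \<Rightarrow> 'a::{real_inner, complete_space}"
  assumes "\<Omega> \<noteq> {}"
    and conv: "\<And>s. s \<in> \<Omega> \<Longrightarrow> convergent (\<lambda>n. norm (s - x n))"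
    and cluster: "\<And>s l. strict_mono s \<Longrightarrow> weakly_converges (x \<circ> s) l \<Longrightarrow> l \<in> \<Omega>"
  shows "\<exists>l\<in>\<Omega>. weakly_converges x l"
proof -
  obtain c where "c \<in> \<Omega>" using assms(1) by blast
  obtain C where C: "\<And>n. norm (c - x n) \<le> C"
    using convergent_imp_Bseq[OF conv[OF \<open>c \<in> \<Omega>\<close>]] by (auto simp: Bseq_def)
  have B: "norm (x n) \<le> C + norm c" for n
    using C[of n] norm_triangle_sub[of "x n" c] by (simp add: norm_minus_commute)
  have unique: "k = l" if "strict_mono s" "weakly_converges (x \<circ> s) k"
    "strict_mono t" "weakly_converges (x \<circ> t) l" for s t k l
  proof -
    have "k \<in> \<Omega>" "l \<in> \<Omega>" using cluster that by auto
    then obtain c d where "(\<lambda>n. norm (k - x n)) \<longlonglongrightarrow> c" "(\<lambda>n. norm (l - x n)) \<longlonglongrightarrow> d"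
      using conv unfolding convergent_def by blast
    then have "(\<lambda>n. ((norm (l - x n))\<^sup>2 - (norm (k - x n))\<^sup>2 - l \<bullet> l + k \<bullet> k) / 2)
        \<longlonglongrightarrow> (d\<^sup>2 - c\<^sup>2 - l \<bullet> l + k \<bullet> k) / 2"
      by (intro tendsto_intros) auto
    moreover have "((norm (l - x n))\<^sup>2 - (norm (k - x n))\<^sup>2 - l \<bullet> l + k \<bullet> k) / 2 = (k - l) \<bullet> x n" for n
      by (simp add: power2_norm_eq_inner inner_simps inner_commute)
    ultimately obtain a where a: "(\<lambda>n. (k - l) \<bullet> x n) \<longlonglongrightarrow> a" by simp
    have "(k - l) \<bullet> k = a"
      using LIMSEQ_unique[OF weakly_converges_inner[OF that(2)]]
        LIMSEQ_subseq_LIMSEQ[OF a that(1)] by (simp add: o_def)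
    moreover have "(k - l) \<bullet> l = a"
      using LIMSEQ_unique[OF weakly_converges_inner[OF that(4)]]
        LIMSEQ_subseq_LIMSEQ[OF a that(3)] by (simp add: o_def)
    \<comment> \<open>Both subsequences inherit the limit \<open>a\<close>, so \<open>k - l\<close>
      is orthogonal to itself.\<close>
    ultimately have "(k - l) \<bullet> (k - l) = 0" by (simp add: inner_diff_right)
    then show "k = l" by simp
  qed
  obtain s l where s: "strict_mono s" "weakly_converges (x \<circ> s) l"
    by (rule bounded_imp_weakly_convergent_subsequence[where x = x, OF B])
  \<comment> \<open>If this failed, \<open>f\<close> would stay \<open>e\<close> away from
    \<open>f l\<close> along some subsequence; that one has a weakly convergent subsequence, whose
    limit is \<open>l\<close> by \<open>unique\<close>.\<close>
  have "(\<lambda>n. f (x n)) \<longlonglongrightarrow> f l" if f: "bounded_linear f" for f :: "'a \<Rightarrow> real"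
  proof (rule ccontr)
    assume "\<not> (\<lambda>n. f (x n)) \<longlonglongrightarrow> f l"
    then obtain e where e: "e > 0" "\<not> (\<forall>\<^sub>F n in sequentially. dist (f (x n)) (f l) < e)"
      unfolding tendsto_iff by blast
    then obtain t :: "nat \<Rightarrow> nat" where t: "strict_mono t" "\<And>n. \<not> dist (f (x (t n))) (f l) < e"
      using not_eventually_sequentiallyD[OF e(2)] by blast
    have "norm ((x \<circ> t) n) \<le> C + norm c" for n using B by simp
    then obtain q k where q: "strict_mono q" "weakly_converges ((x \<circ> t) \<circ> q) k"
      by (rule bounded_imp_weakly_convergent_subsequence)
    have "k = l"
      using unique[of "t \<circ> q" k s l] strict_mono_o[OF t(1) q(1)] q(2) s by (simp add: o_assoc)
    then have "(\<lambda>n. f (x (t (q n)))) \<longlonglongrightarrow> f l"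
      using q(2) f by (auto simp: weakly_converges_def)
    then have "\<forall>\<^sub>F n in sequentially. dist (f (x (t (q n)))) (f l) < e"
      using e(1) by (rule tendstoD)
    then have "\<forall>\<^sub>F n::nat in sequentially. False"
      by (rule eventually_mono) (use t(2) in blast)
    then show False by simp
  qed
  then have "weakly_converges x l" unfolding weakly_converges_def by blast
  moreover have "l \<in> \<Omega>" using cluster s by blast
  ultimately show ?thesis by blast
qed

section \<open>The perturbed iteration\<close>

theorem theorem3p1:
  fixes \<Omega> :: "'a::{real_inner, complete_space} set"
    and F :: "nat \<Rightarrow> 'a \<Rightarrow> 'a set"
    and x r :: "nat \<Rightarrow> 'a"
  assumes "\<Omega> \<noteq> {}"
    and "P1 F \<Omega>"
    and "P2 F \<Omega>"
    and "\<forall>n\<ge>1. x n \<in> (\<lambda>y. y + r n) ` F n (x (n - 1))"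
    and "summable (\<lambda>n. norm (r (Suc n)))"
  shows "quasi_fejer x \<Omega>
    \<and> (\<exists>xbar\<in>\<Omega>. weakly_converges x xbar)
    \<and> (\<forall>s\<in>\<Omega>. convergent (\<lambda>n. norm (s - x n)))
    \<and> ((\<forall>n\<ge>1. r n = 0) \<longrightarrow> fejer x \<Omega>)"
proof -
  \<comment> \<open>P1 and P2 speak about the unperturbed point \<open>x n - r n\<close>, not about
    \<open>x n\<close>.\<close>
  have inF: "x n - r n \<in> F n (x (n - 1))" if "n \<ge> 1" for n
    using assms(4) that by fastforce
  have step: "norm (s - x n) \<le> norm (s - x (n - 1)) + norm (r n)" if "n \<ge> 1" "s \<in> \<Omega>" for n s
  proof -
    have "norm (s - (x n - r n)) \<le> norm (s - x (n - 1))"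
      using assms(2) inF[OF that(1)] that unfolding P1_def by blast
    moreover have "norm (s - x n) \<le> norm (s - (x n - r n)) + norm (r n)"
      using norm_triangle_ineq4[of "s - (x n - r n)" "r n"] by simp
    ultimately show ?thesis by linarith
  qed
  have quasi: "quasi_fejer x \<Omega>"
    unfolding quasi_fejer_def
    using step assms(5) by (intro ballI exI[of _ "\<lambda>n. norm (r n)"]) auto
  have conv: "convergent (\<lambda>n. norm (s - x n))" if "s \<in> \<Omega>" for s
    by (rule convergent_of_summable_perturbation[OF _ _ assms(5)])
      (use step[OF _ that, of "Suc n" for n] in auto)
  have "l \<in> \<Omega>" if p: "strict_mono p" and l: "weakly_converges (x \<circ> p) l" for p l
  proof -
    obtain c where "c \<in> \<Omega>" using assms(1) by blast
    obtain L where L: "(\<lambda>n. norm (c - x n)) \<longlonglongrightarrow> L"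
      using conv[OF \<open>c \<in> \<Omega>\<close>] by (auto simp: convergent_def)
    have "(\<lambda>n. norm (c - x (Suc n)) - norm (c - (x (Suc n) - r (Suc n)))) \<longlonglongrightarrow> 0"
    proof (rule Lim_null_comparison[OF _ summable_LIMSEQ_zero[OF assms(5)]])
      show "\<forall>\<^sub>F n in sequentially. norm (norm (c - x (Suc n)) - norm (c - (x (Suc n) - r (Suc n))))
        \<le> norm (r (Suc n))"
        using norm_triangle_ineq3[of "c - x (Suc n)" "c - (x (Suc n) - r (Suc n))" for n]
        by (intro always_eventually) simp
    qed
    \<comment> \<open>Consecutive distances to \<open>c\<close> share the limit \<open>L\<close>,
      and removing \<open>r (Suc n)\<close> changes the later one by a null sequence.\<close>
    from tendsto_add[OF tendsto_diff[OF L LIMSEQ_Suc[OF L]] this]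
    have "(\<lambda>n. norm (c - x n) - norm (c - (x (Suc n) - r (Suc n)))) \<longlonglongrightarrow> 0" by simp
    from LIMSEQ_subseq_LIMSEQ[OF this p]
    have "(\<lambda>k. norm (c - (x \<circ> p) k) - norm (c - (x (Suc (p k)) - r (Suc (p k))))) \<longlonglongrightarrow> 0"
      by (simp add: o_def)
    \<comment> \<open>The map applied to \<open>x (p k)\<close> has index \<open>Suc (p k)\<close>,
      which is at least 1 even if \<open>p k = 0\<close>.\<close>
    moreover have "strict_mono (\<lambda>k. Suc (p k))" using p by (simp add: strict_mono_def)
    moreover have "x (Suc (p k)) - r (Suc (p k)) \<in> F (Suc (p k)) ((x \<circ> p) k)" for k
      using inF[of "Suc (p k)"] by simp
    ultimately show ?thesis
      using assms(3)[unfolded P2_def, rule_format, of "x \<circ> p" l "\<lambda>k. Suc (p k)"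
          "\<lambda>k. x (Suc (p k)) - r (Suc (p k))"] l \<open>c \<in> \<Omega>\<close> by auto
  qed
  then have "\<exists>l\<in>\<Omega>. weakly_converges x l" using opial[OF assms(1) conv] by blast
  moreover have "fejer x \<Omega>" if "\<forall>n\<ge>1. r n = 0"
    unfolding fejer_def using step that by fastforce
  ultimately show ?thesis using quasi conv by blast
qed

end
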